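(* Let $X$ be a hereditary class of graphs and let $c$ be a constant. Suppose that for every graph $G$ in $X$ there are a vertex $y\in V(G)$ and two disjoint sets $U,R\subseteq V(G)\setminus\{y\}$, each of at most $c$ vertices, such that $y$ is a function of $U$ in the graph $G\setminus R$. Then $X_n=2^{O(n\log n)}$.
   Context: Graphs are finite, simple and undirected, with nonempty vertex set. A class of graphs is a set of graphs closed under isomorphism; it is hereditary if it is closed under taking induced subgraphs. $X_n$ denotes the number of labelled graphs in $X$ with vertex set $\{1,\ldots,n\}$. For vertices $u,v$ of a graph, $m(u,v)=1$ if $u$ and $v$ are adjacent and $m(u,v)=0$ otherwise. In a graph $G=(V,E)$, a vertex $y\in V$ is a function of a set of vertices $\{x_1,\ldots,x_k\}\subseteq V$ if there exists a Boolean function $f:\{0,1\}^k\to\{0,1\}$ of $k$ variables such that for every vertex $z\in V\setminus\{y,x_1,\ldots,x_k\}$, $m(y,z)=f(m(x_1,z),\ldots,m(x_k,z))$; here $k=0$ (the empty set, with $f$ a constant) is allowed. $G\setminus R$ is the subgraph of $G$ induced by $V(G)\setminus R$. *)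

theory Defs
  imports
    Complex_Main
    "HOL-Library.Landau_Symbols"
    "Graph_Theory.Digraph_Component"
    "Graph_Theory.Digraph_Isomorphism"
begin

text \<open>
  A finite simple undirected graph is a \<^locale>\<open>pair_graph\<close> (finite, loop-free, symmetric arc relation),
  each edge being represented by its two arcs. Since every finite graph has an isomorphic copy on
  natural numbers, classes of graphs are sets of graphs with vertices in \<^typ>\<open>nat\<close>.
\<close>

definition graph_class :: "nat pair_pre_digraph set \<Rightarrow> bool" where
  "graph_class X \<longleftrightarrow>
     (\<forall>G\<in>X. pair_graph G \<and> pverts G \<noteq> {}) \<and>
     (\<forall>G\<in>X. \<forall>H. pair_graph H \<and> digraph_iso (with_proj G) (with_proj H) \<longrightarrow> H \<in> X)"

definition hereditary :: "nat pair_pre_digraph set \<Rightarrow> bool" where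
  "hereditary X \<longleftrightarrow>
     (\<forall>G\<in>X. \<forall>H. induced_subgraph (with_proj H) (with_proj G) \<and> pverts H \<noteq> {} \<longrightarrow> H \<in> X)"

definition labelled_count :: "nat pair_pre_digraph set \<Rightarrow> nat \<Rightarrow> nat" where
  "labelled_count X n = card {G \<in> X. pverts G = {1..n}}"

text \<open>
  The list \<open>xs\<close> enumerates \<open>U\<close> without repetition, and the Boolean function \<open>f\<close> of \<open>card U\<close> variables
  is only ever applied to lists of length \<open>card U\<close>.
\<close>

definition function_of :: "('a, 'b) pre_digraph \<Rightarrow> 'a \<Rightarrow> 'a set \<Rightarrow> bool" where
  "function_of G y U \<longleftrightarrow>
     y \<in> verts G \<and> U \<subseteq> verts G \<and>
     (\<exists>(xs :: 'a list) (f :: bool list \<Rightarrow> bool). distinct xs \<and> set xs = U \<and>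
        (\<forall>z \<in> verts G - insert y U. (y \<rightarrow>\<^bsub>G\<^esub> z) \<longleftrightarrow> f (map (\<lambda>x. x \<rightarrow>\<^bsub>G\<^esub> z) xs)))"

definition delete_verts :: "('a, 'b) pre_digraph \<Rightarrow> 'a set \<Rightarrow> ('a, 'b) pre_digraph" where
  "delete_verts G R = G \<restriction> (verts G - R)"

end

theory Submission
  imports Defs "HOL-Real_Asymp.Real_Asymp"
begin

text \<open>
  The idea is that a graph of the class is a vertex-deleted graph of the class plus \<open>O(log n)\<close> bits.
  Let \<open>y\<close> be a function of \<open>U\<close> in \<open>G \<setminus> R\<close>. Outside the at most \<open>2c\<close> vertices of \<open>U \<union> R\<close>, the
  neighbourhood of \<open>y\<close> can be read off from \<open>G - y\<close> once \<open>U\<close> and the Boolean function are known;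
  on \<open>U \<union> R\<close> it is listed explicitly. So \<open>G\<close> is determined by \<open>y\<close>, by three lists of at most \<open>2c\<close>
  vertices, by one of a constant number of truth tables, and by \<open>G - y\<close>
  (\<open>function_of_imp_coded_nbhd\<close>, \<open>add_vertex_remove_vertex\<close>).

  With \<open>n\<close> vertices this leaves at most \<open>K * n\<^sup>a\<close> choices besides \<open>G - y\<close>, where \<open>K\<close> and \<open>a\<close>
  depend on \<open>c\<close> only. As \<open>G - y\<close> lies in the class again, induction on the number of vertices gives
  at most \<open>(K * n\<^sup>a)\<^sup>n\<close> labelled graphs (\<open>card_labelled_le\<close>), and the binary logarithm of this
  number is \<open>n * (log K + a * log n)\<close>. The vertex \<open>y\<close> differs from graph to graph, so the induction
  runs over arbitrary finite vertex sets rather than over the sets \<open>{1..n}\<close>.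
\<close>

section \<open>Deleting and restoring a vertex\<close>

definition remove_vertex :: "'a \<Rightarrow> 'a pair_pre_digraph \<Rightarrow> 'a pair_pre_digraph" where
  "remove_vertex y G =
     \<lparr>pverts = pverts G - {y}, parcs = Restr (parcs G) (pverts G - {y})\<rparr>"

definition add_vertex :: "'a \<Rightarrow> 'a set \<Rightarrow> 'a pair_pre_digraph \<Rightarrow> 'a pair_pre_digraph" where
  "add_vertex y N H =
     \<lparr>pverts = insert y (pverts H), parcs = parcs H \<union> {y} \<times> N \<union> N \<times> {y}\<rparr>"

lemma pair_graph_parcs:
  assumes "pair_graph G"
  shows "finite (pverts G)" "(u, v) \<in> parcs G \<Longrightarrow> u \<in> pverts G \<and> v \<in> pverts G \<and> u \<noteq> v"
    "(u, v) \<in> parcs G \<Longrightarrow> (v, u) \<in> parcs G"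
proof -
  interpret pair_graph G by fact
  show "finite (pverts G)" by (rule pair_finite_verts)
  show "u \<in> pverts G \<and> v \<in> pverts G \<and> u \<noteq> v" if "(u, v) \<in> parcs G"
    using that wellformed' pair_no_loops by fastforce
  show "(v, u) \<in> parcs G" if "(u, v) \<in> parcs G"
    using that pair_sym_arcs by (auto simp: symmetric_def dest: symD)
qed

lemma add_vertex_remove_vertex:
  assumes "pair_graph G" "y \<in> pverts G"
  shows "add_vertex y {z. (y, z) \<in> parcs G} (remove_vertex y G) = G"
proof (rule pair_pre_digraph.equality)
  show "parcs (add_vertex y {z. (y, z) \<in> parcs G} (remove_vertex y G)) = parcs G"
    using pair_graph_parcs[OF assms(1)] by (auto simp: add_vertex_def remove_vertex_def)
qed (use assms in \<open>auto simp: add_vertex_def remove_vertex_def\<close>)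

lemma hereditary_remove_vertex:
  assumes "graph_class X" "hereditary X" "G \<in> X" "pverts G \<noteq> {y}"
  shows "remove_vertex y G \<in> X"
proof -
  have G: "pair_graph G" "pverts G \<noteq> {}" using assms by (auto simp: graph_class_def)
  then interpret pair_graph G by simp
  have "wf_digraph (with_proj (remove_vertex y G))"
    by unfold_locales (auto simp: remove_vertex_def)
  then have "induced_subgraph (with_proj (remove_vertex y G)) (with_proj G)"
    by (intro induced_subgraphI subgraphI)
       (auto simp: remove_vertex_def compatible_def intro: wf_digraph)
  moreover have "pverts (remove_vertex y G) \<noteq> {}"
    using assms(4) G(2) by (auto simp: remove_vertex_def)
  ultimately show ?thesis using assms by (auto simp: hereditary_def)
qed

section \<open>Codes for the neighbourhood of a vertex\<close>

text \<open>
  In a code \<open>(xs, ps, qs, T)\<close> the list \<open>xs\<close> contains the arguments of the Boolean function, which is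
  given by the set \<open>T\<close> of the inputs where it is true; \<open>ps\<close> lists the exceptional neighbours and \<open>qs\<close>
  the exceptional non-neighbours. Exceptional vertices are given by lists rather than sets because
  lists of bounded length are easy to count; several codes may describe the same neighbourhood.
\<close>

type_synonym 'a nbhd_code = "'a list \<times> 'a list \<times> 'a list \<times> bool list set"

fun coded_nbhd :: "'a pair_pre_digraph \<Rightarrow> 'a nbhd_code \<Rightarrow> 'a set" where
  "coded_nbhd H (xs, ps, qs, T) =
     set ps \<union> {z \<in> pverts H - set qs. map (\<lambda>x. (x, z) \<in> parcs H) xs \<in> T}"

definition short_lists :: "nat \<Rightarrow> 'a set \<Rightarrow> 'a list set" where
  "short_lists d V = {xs. set xs \<subseteq> V \<and> length xs \<le> d}"

definition nbhd_codes :: "nat \<Rightarrow> 'a set \<Rightarrow> 'a nbhd_code set" where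
  "nbhd_codes d V =
     short_lists d V \<times> short_lists d V \<times> short_lists d V \<times> Pow (short_lists d UNIV)"

lemma finite_short_lists: "finite V \<Longrightarrow> finite (short_lists d V)"
  unfolding short_lists_def by (rule finite_lists_length_le)

lemma card_short_lists_le:
  assumes "finite V" "V \<noteq> {}"
  shows "card (short_lists d V) \<le> Suc d * card V ^ d"
proof -
  have "card V \<ge> 1" using assms by (simp add: Suc_leI card_gt_0_iff)
  then have "(\<Sum>i\<le>d. card V ^ i) \<le> of_nat (card {..d}) * card V ^ d"
    by (intro sum_bounded_above power_increasing) auto
  then show ?thesis using assms by (simp add: short_lists_def card_lists_length_le)
qed

lemma finite_nbhd_codes: "finite V \<Longrightarrow> finite (nbhd_codes d V)"
  by (simp add: nbhd_codes_def finite_short_lists)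

text \<open>
  The number of truth tables does not depend on \<open>V\<close>, which is why the bound is polynomial in \<open>card V\<close>.
\<close>

lemma card_nbhd_codes_le:
  assumes "finite V" "V \<noteq> {}"
  shows "card (nbhd_codes d V)
    \<le> (Suc d ^ 3 * 2 ^ card (short_lists d (UNIV :: bool set))) * card V ^ (3 * d)"
proof -
  let ?s = "card (short_lists d V)" and ?b = "Suc d * card V ^ d"
  have "?s * (?s * (?s * 2 ^ card (short_lists d (UNIV :: bool set))))
      \<le> ?b * (?b * (?b * 2 ^ card (short_lists d (UNIV :: bool set))))"
    using card_short_lists_le[OF assms] by (intro mult_le_mono) auto
  moreover have "card V ^ (3 * d) = card V ^ d * card V ^ d * card V ^ d"
    by (simp add: numeral_3_eq_3 add.assoc flip: power_add)
  ultimately show ?thesis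
    by (simp add: nbhd_codes_def card_cartesian_product card_Pow finite_short_lists
        power3_eq_cube mult_ac del: mult_Suc mult_Suc_right)
qed

text \<open>
  The code takes as exceptional the vertices of \<open>U \<union> R\<close>. For every other \<open>z\<close> the function is evaluated
  at adjacencies between \<open>z\<close> and \<open>U\<close>. Both avoid \<open>y\<close> and \<open>R\<close>, so these adjacencies are the same in
  \<open>G \<setminus> R\<close> and in \<open>G - y\<close>; hence decoding needs \<open>G - y\<close> only.
\<close>

lemma function_of_imp_coded_nbhd:
  assumes G: "pair_graph G" and "y \<in> pverts G"
    and U: "U \<subseteq> pverts G - {y}" and R: "R \<subseteq> pverts G - {y}" and "U \<inter> R = {}"
    and c: "card U \<le> c" "card R \<le> c"
    and fn: "function_of (delete_verts (with_proj G) R) y U"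
  shows "\<exists>code \<in> nbhd_codes (2 * c) (pverts G).
    coded_nbhd (remove_vertex y G) code = {z. (y, z) \<in> parcs G}"
proof -
  note G_arcs = pair_graph_parcs[OF G]
  define N where "N = {z. (y, z) \<in> parcs G}"
  have arcs: "u \<rightarrow>\<^bsub>delete_verts (with_proj G) R\<^esub> v \<longleftrightarrow> (u, v) \<in> parcs G \<and> u \<notin> R \<and> v \<notin> R" for u v
    using G_arcs(2)[of u v]
    by (auto simp: delete_verts_def arcs_ends_conv)
  from fn obtain xs f where xs: "distinct xs" "set xs = U"
    and f: "\<forall>z \<in> verts (delete_verts (with_proj G) R) - insert y U.
      y \<rightarrow>\<^bsub>delete_verts (with_proj G) R\<^esub> z \<longleftrightarrow>
      f (map (\<lambda>x. x \<rightarrow>\<^bsub>delete_verts (with_proj G) R\<^esub> z) xs)"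
    unfolding function_of_def by blast
  have fin: "finite (U \<union> R)"
    using U R G_arcs(1) by (meson Diff_subset finite_Un finite_subset order_trans)
  have card_UR: "card (U \<union> R) \<le> 2 * c" using card_Un_le[of U R] c by linarith
  obtain ps where ps: "set ps = (U \<union> R) \<inter> N" "distinct ps"
    using finite_distinct_list fin by (metis finite_Int)
  obtain qs where qs: "set qs = (U \<union> R) - N" "distinct qs"
    using finite_distinct_list fin by (metis finite_Diff)
  have len: "length ps \<le> 2 * c" "length qs \<le> 2 * c" "length xs \<le> 2 * c"
  proof -
    show "length ps \<le> 2 * c"
      using ps card_UR fin card_mono[of "U \<union> R" "(U \<union> R) \<inter> N"]
      by (metis Int_lower1 distinct_card le_trans)
    show "length qs \<le> 2 * c"
      using qs card_UR fin card_mono[of "U \<union> R" "(U \<union> R) - N"]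
      by (metis Diff_subset distinct_card le_trans)
    show "length xs \<le> 2 * c" using distinct_card[OF xs(1)] xs(2) c(1) by simp
  qed
  \<comment> \<open>\<open>f\<close> is arbitrary on lists of other lengths; dropping these makes \<open>T\<close> a set of short lists.\<close>
  define T where "T = {bs. length bs = length xs \<and> f bs}"
  have "(xs, ps, qs, T) \<in> nbhd_codes (2 * c) (pverts G)"
    using len xs ps qs U R by (auto simp: nbhd_codes_def short_lists_def T_def)
  moreover have "coded_nbhd (remove_vertex y G) (xs, ps, qs, T) = N"
  proof -
    have outside: "map (\<lambda>x. (x, z) \<in> parcs (remove_vertex y G)) xs \<in> T \<longleftrightarrow> z \<in> N"
      if z: "z \<in> pverts G - {y}" "z \<notin> U \<union> R" for z
    proof -
      have "map (\<lambda>x. (x, z) \<in> parcs (remove_vertex y G)) xs =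
          map (\<lambda>x. (x, z) \<in> parcs G \<and> x \<notin> R \<and> z \<notin> R) xs"
        using z xs U \<open>U \<inter> R = {}\<close> by (auto simp: remove_vertex_def)
      moreover have "z \<in> verts (delete_verts (with_proj G) R) - insert y U"
        using z by (auto simp: delete_verts_def)
      ultimately show ?thesis
        using bspec[OF f, of z] z R unfolding arcs by (auto simp: T_def N_def simp del: map_eq_conv)
    qed
    have "N \<subseteq> pverts G - {y}" using G_arcs(2) by (auto simp: N_def)
    moreover have "pverts (remove_vertex y G) = pverts G - {y}" by (simp add: remove_vertex_def)
    ultimately show ?thesis using ps qs outside by (auto simp: subset_iff)
  qed
  ultimately show ?thesis unfolding N_def by blast
qed

section \<open>Counting\<close>

text \<open>
  Every graph on \<open>V\<close> is built from a vertex \<open>y\<close>, a code, and a graph of the family on \<open>V - {y}\<close>;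
  the image of all these triples is thus at least as large as the family on \<open>V\<close>. The induction starts at
  one vertex, because deleting the only vertex may leave the family.
\<close>

lemma card_labelled_le:
  fixes X :: "'a pair_pre_digraph set"
  defines "K \<equiv> \<lambda>d. Suc d ^ 3 * 2 ^ card (short_lists d (UNIV :: bool set))"
  assumes graph: "\<And>G. G \<in> X \<Longrightarrow> pair_graph G"
    and remove: "\<And>G y. G \<in> X \<Longrightarrow> pverts G \<noteq> {y} \<Longrightarrow> remove_vertex y G \<in> X"
    and code: "\<And>G. G \<in> X \<Longrightarrow> \<exists>y \<in> pverts G. \<exists>code \<in> nbhd_codes d (pverts G).
          coded_nbhd (remove_vertex y G) code = {z. (y, z) \<in> parcs G}"
    and "finite V" "V \<noteq> {}"
  shows "finite {G \<in> X. pverts G = V} \<and>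
    card {G \<in> X. pverts G = V} \<le> (K d * card V ^ Suc (3 * d)) ^ card V"
  using assms(5,6)
proof (induction "card V" arbitrary: V)
  case 0
  then show ?case by simp
next
  case (Suc n)
  let ?X = "\<lambda>V. {G \<in> X. pverts G = V}" and ?a = "Suc (3 * d)"
  have K_pos: "K d > 0" by (simp add: K_def)
  show ?case
  proof (cases "n = 0")
    case True
    then obtain v where v: "V = {v}" using Suc.hyps(2) by (metis One_nat_def card_1_singletonE)
    have "?X V \<subseteq> {\<lparr>pverts = {v}, parcs = {}\<rparr>}"
    proof
      fix G assume G: "G \<in> ?X V"
      then have "parcs G = {}" using pair_graph_parcs(2)[OF graph, of G] v by fastforce
      then show "G \<in> {\<lparr>pverts = {v}, parcs = {}\<rparr>}" using G v by (cases G) auto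
    qed
    then have "finite (?X V)" "card (?X V) \<le> 1"
      using finite_subset card_mono by (auto dest: card_mono[rotated])
    moreover have "1 \<le> K d" using K_pos by simp
    ultimately show ?thesis using v by simp
  next
    case False
    define D where "D = (SIGMA y:V. nbhd_codes d V \<times> ?X (V - {y}))"
    let ?build = "\<lambda>(y, code, H). add_vertex y (coded_nbhd H code) H"
    have IH: "finite (?X (V - {y}))"
      "card (?X (V - {y})) \<le> (K d * n ^ ?a) ^ n" if "y \<in> V" for y
    proof -
      have *: "n = card (V - {y})" "finite (V - {y})" using Suc that by auto
      moreover have "V - {y} \<noteq> {}" using False * by force
      ultimately show "finite (?X (V - {y}))" "card (?X (V - {y})) \<le> (K d * n ^ ?a) ^ n"
        using Suc.hyps(1)[of "V - {y}"] by auto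
    qed
    have finD: "finite D"
      unfolding D_def by (intro finite_SigmaI finite_cartesian_product finite_nbhd_codes IH(1) Suc.prems)
    have sub: "?X V \<subseteq> ?build ` D"
    proof
      fix G assume G: "G \<in> ?X V"
      then obtain y code where y: "y \<in> V" "code \<in> nbhd_codes d V"
        "coded_nbhd (remove_vertex y G) code = {z. (y, z) \<in> parcs G}"
        using code by blast
      have "V \<noteq> {y}" using False Suc.hyps(2) by auto
      then have "remove_vertex y G \<in> ?X (V - {y})"
        using remove G by (auto simp: remove_vertex_def)
      then have "(y, code, remove_vertex y G) \<in> D" using y by (auto simp: D_def)
      moreover have "G = ?build (y, code, remove_vertex y G)"
        using add_vertex_remove_vertex[OF graph, of G y] G y by simp
      ultimately show "G \<in> ?build ` D" by (rule rev_image_eqI)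
    qed
    have "card (?X V) \<le> card D" using surj_card_le[OF finD sub] .
    also have "\<dots> = (\<Sum>y\<in>V. card (nbhd_codes d V) * card (?X (V - {y})))"
      unfolding D_def using Suc.prems(1)
      by (simp add: card_SigmaI IH(1) finite_nbhd_codes card_cartesian_product)
    also have "\<dots> \<le> (\<Sum>y\<in>V. (K d * card V ^ (3 * d)) * (K d * card V ^ ?a) ^ n)"
    \<comment> \<open>Passing from \<open>n\<close> to \<open>card V = n + 1\<close> in the inductive bound makes all factors equal, apart
       from one \<open>card V\<close> that the choice of \<open>y\<close> contributes.\<close>
    proof (intro sum_mono mult_le_mono)
      fix y assume "y \<in> V"
      show "card (nbhd_codes d V) \<le> K d * card V ^ (3 * d)"
        unfolding K_def using card_nbhd_codes_le Suc.prems by blast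
      have "(K d * n ^ ?a) ^ n \<le> (K d * card V ^ ?a) ^ n"
        using Suc.hyps(2) by (intro power_mono mult_le_mono) auto
      then show "card (?X (V - {y})) \<le> (K d * card V ^ ?a) ^ n"
        using IH(2)[OF \<open>y \<in> V\<close>] by linarith
    qed
    also have "\<dots> = (K d * card V ^ ?a) ^ card V"
      by (simp add: algebra_simps flip: Suc.hyps(2))
    finally show ?thesis using finite_subset[OF sub] finD by blast
  qed
qed

lemma power_eq_two_powr_n_log_n:
  fixes K a :: nat
  assumes "K > 0"
  shows "\<exists>g :: nat \<Rightarrow> real. g \<in> O(\<lambda>n. real n * ln (real n)) \<and>
    (\<forall>n. n > 0 \<longrightarrow> real ((K * n ^ a) ^ n) = 2 powr g n)"
proof (intro exI conjI allI impI)
  let ?g = "\<lambda>n. real n * (log 2 K + real a * log 2 n)"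
  show "?g \<in> O(\<lambda>n. real n * ln (real n))"
    unfolding log_def by real_asymp
  show "real ((K * n ^ a) ^ n) = 2 powr ?g n" if "n > 0" for n
  proof -
    have "log 2 (real ((K * n ^ a) ^ n)) = ?g n"
      using assms that by (simp add: log_nat_power log_mult)
    moreover have "real ((K * n ^ a) ^ n) > 0" using assms that by simp
    ultimately show ?thesis using powr_log_cancel[of 2 "real ((K * n ^ a) ^ n)"] by simp
  qed
qed

theorem theorem2:
  fixes X :: "nat pair_pre_digraph set" and c :: nat
  assumes "graph_class X"
    and "hereditary X"
    and "\<And>G. G \<in> X \<Longrightarrow>
           \<exists>y\<in>pverts G. \<exists>U R. U \<subseteq> pverts G - {y} \<and> R \<subseteq> pverts G - {y} \<and> U \<inter> R = {} \<and>
             card U \<le> c \<and> card R \<le> c \<and>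
             function_of (delete_verts (with_proj G) R) y U"
  shows "\<exists>g :: nat \<Rightarrow> real. g \<in> O(\<lambda>n. real n * ln (real n)) \<and>
           (\<forall>n. real (labelled_count X n) \<le> 2 powr g n)"
proof -
  define K where "K = Suc (2 * c) ^ 3 * 2 ^ card (short_lists (2 * c) (UNIV :: bool set))"
  define a where "a = Suc (3 * (2 * c))"
  have graph: "pair_graph G" if "G \<in> X" for G
    using that assms(1) by (auto simp: graph_class_def)
  have code: "\<exists>y\<in>pverts G. \<exists>code \<in> nbhd_codes (2 * c) (pverts G).
      coded_nbhd (remove_vertex y G) code = {z. (y, z) \<in> parcs G}" if "G \<in> X" for G
    using assms(3)[OF that] function_of_imp_coded_nbhd[OF graph[OF that]] by metis
  have bound: "labelled_count X n \<le> (K * n ^ a) ^ n" if "n > 0" for n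
    using card_labelled_le[OF graph hereditary_remove_vertex[OF assms(1,2)] code, of "{1..n}"] that
    by (simp add: labelled_count_def K_def a_def)
  have "{G \<in> X. pverts G = {1..0}} = {}" using assms(1) by (auto simp: graph_class_def)
  then have zero: "labelled_count X 0 = 0" unfolding labelled_count_def by (metis card.empty)
  obtain g where g: "g \<in> O(\<lambda>n. real n * ln (real n))"
    and "\<forall>n. n > 0 \<longrightarrow> real ((K * n ^ a) ^ n) = 2 powr g n"
    using power_eq_two_powr_n_log_n[of K a] by (auto simp: K_def)
  then have "real (labelled_count X n) \<le> 2 powr g n" for n
    using bound[of n] zero by (cases "n = 0") (auto simp flip: of_nat_le_iff[where 'a = real])
  with g show ?thesis by blast
qed

end
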